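(* Let $\varepsilon\in\{1,-1\}$, $d\in\{0,1,2\}$, and let $s<0$ be an odd integer. For all positive integers $n,m$ with $(1-s)/2\le m\le n-s$, $$\sum_{k=-n}^m \varepsilon^{k+d}\left(\frac{k+d}{3}\right) q^{\frac{k^2+sk}{2}}\begin{bmatrix} n+m\\ n+k\end{bmatrix} =\frac{(-\varepsilon q^3;q^3)_{m+(s-1)/2}}{(-\varepsilon q;q)_{m+(s-1)/2}}\;\mathcal{L}_z\left(q^{\frac{1-s^2}{8}}(\varepsilon z)^{d-\frac{s+1}{2}}(1+\varepsilon z)\,(-\varepsilon q^{m+\frac{s+1}{2}}/z;q)_{n-m-s}\right).$$
   Context: Here $q$ and $z$ are formal variables. The $q$-shifted factorial is $(a;q)_n=(1-a)(1-aq)\cdots(1-aq^{n-1})$ for $n\ge 1$ and $(a;q)_0=1$; likewise $(a;q^3)_n$ is the same with $q$ replaced by $q^3$. The $q$-binomial coefficient is $\begin{bmatrix} n\\ k\end{bmatrix}=\frac{(q;q)_n}{(q;q)_k(q;q)_{n-k}}$ if $0\le k\le n$, and $0$ otherwise. The Legendre symbol modulo $3$ is $\left(\frac{j}{3}\right)=0,1,-1$ according as $j\equiv 0,1,-1\pmod 3$, for any integer $j$. For a formal Laurent series $f(z)=\sum_{k=-\infty}^{\infty}c_kz^k$ in $z$ (with coefficients $c_k$ that do not involve $z$ but may involve $q$), the operator $\mathcal{L}_z$ is defined by $\mathcal{L}_z(f(z))=\sum_{k=-\infty}^{\infty}\left(\frac{k}{3}\right)c_k$; here it is applied only to Laurent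 polynomials in $z$, so the sum is finite. *)

theory Defs
  imports
    "HOL-Computational_Algebra.Computational_Algebra"
    "HOL-Number_Theory.Number_Theory"
begin

text \<open>
  The formal variable \<open>q\<close> is the generator of the field \<open>\<rat>(q)\<close> of rational functions, and
  Laurent polynomials in \<open>z\<close> live in the field of formal Laurent series over \<open>\<rat>(q)\<close>, with
  \<open>z = fls_X\<close>.
\<close>

type_synonym qfield = "rat poly fract"

definition qvar :: qfield
  where "qvar = Fract [:0, 1:] 1"

definition qpoch :: "'a::comm_ring_1 \<Rightarrow> 'a \<Rightarrow> nat \<Rightarrow> 'a"
  where "qpoch a b n = (\<Prod>i<n. 1 - a * b ^ i)"

definition qbinom :: "'a::field \<Rightarrow> int \<Rightarrow> int \<Rightarrow> 'a"
  where "qbinom b n k =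
    (if 0 \<le> k \<and> k \<le> n
     then qpoch b b (nat n) / (qpoch b b (nat k) * qpoch b b (nat (n - k)))
     else 0)"

text \<open>
  The sum ranges over the support, so this is meaningful only for Laurent polynomials
  (with the usual convention, it is \<open>0\<close> on series with infinite support).
\<close>

definition Lz :: "'a::ring_1 fls \<Rightarrow> 'a"
  where "Lz f = (\<Sum>k | fls_nth f k \<noteq> 0. of_int (Legendre k 3) * fls_nth f k)"

lemma Legendre_3:
  "Legendre j 3 = (if j mod 3 = 0 then 0 else if j mod 3 = 1 then 1 else - 1)"
proof -
  have sq: "y\<^sup>2 mod 3 = 0 \<or> y\<^sup>2 mod 3 = 1" for y :: int
  proof -
    have "y mod 3 = 0 \<or> y mod 3 = 1 \<or> y mod 3 = 2" by presburger
    moreover have "y\<^sup>2 mod 3 = (y mod 3)\<^sup>2 mod 3" by (simp add: power_mod)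
    ultimately show ?thesis by auto
  qed
  have one: "QuadRes 3 j" if "j mod 3 = 1"
    unfolding QuadRes_def cong_def using that by (intro exI[of _ 1]) simp
  have two: "\<not> QuadRes 3 j" if "j mod 3 \<noteq> 0" "j mod 3 \<noteq> 1"
  proof
    assume "QuadRes 3 j"
    then obtain y where "y\<^sup>2 mod 3 = j mod 3" unfolding QuadRes_def cong_def by blast
    with sq[of y] that show False by auto
  qed
  show ?thesis
    unfolding Legendre_def cong_def using one two by auto
qed

text \<open>The Laurent series to which \<open>Lz\<close> is applied are products of factors of the following
  kinds, hence Laurent polynomials.\<close>

lemma finite_support_mult:
  fixes f g :: "'a::semiring_0 fls"
  assumes "finite {k. fls_nth f k \<noteq> 0}" "finite {k. fls_nth g k \<noteq> 0}"
  shows "finite {k. fls_nth (f * g) k \<noteq> 0}"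
proof (rule finite_subset)
  show "finite ((\<lambda>(a, b). a + b) ` ({k. fls_nth f k \<noteq> 0} \<times> {k. fls_nth g k \<noteq> 0}))"
    using assms by simp
  show "{k. fls_nth (f * g) k \<noteq> 0}
      \<subseteq> (\<lambda>(a, b). a + b) ` ({k. fls_nth f k \<noteq> 0} \<times> {k. fls_nth g k \<noteq> 0})"
  proof
    fix n assume "n \<in> {k. fls_nth (f * g) k \<noteq> 0}"
    then have "(\<Sum>i = fls_subdegree f + fls_subdegree g..n.
        fls_nth f (i - fls_subdegree g) * fls_nth g (fls_subdegree g + n - i)) \<noteq> 0"
      by (simp add: fls_times_nth)
    then obtain i where "fls_nth f (i - fls_subdegree g) * fls_nth g (fls_subdegree g + n - i) \<noteq> 0"
      by (meson sum.not_neutral_contains_not_neutral)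
    then have "fls_nth f (i - fls_subdegree g) \<noteq> 0" "fls_nth g (fls_subdegree g + n - i) \<noteq> 0"
      by auto
    moreover have "n = (i - fls_subdegree g) + (fls_subdegree g + n - i)" by simp
    ultimately show "n \<in> (\<lambda>(a, b). a + b) ` ({k. fls_nth f k \<noteq> 0} \<times> {k. fls_nth g k \<noteq> 0})"
      by (intro image_eqI[of _ _ "(i - fls_subdegree g, fls_subdegree g + n - i)"]) auto
  qed
qed

lemma finite_support_const: "finite {k. fls_nth (fls_const c) k \<noteq> 0}"
  by (rule finite_subset[of _ "{0}"]) auto

lemma finite_support_powi:
  fixes c :: "'a::field"
  shows "finite {k. fls_nth ((fls_const c * fls_X) powi e) k \<noteq> 0}"
proof -
  have const: "fls_const c powi e = fls_const (c powi e)"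
    by (simp add: power_int_def fls_const_power fls_inverse_const)
  have X: "(fls_X powi e :: 'a fls) = fls_X_intpow e"
  proof (cases "e \<ge> 0")
    case True
    then have "(fls_X powi e :: 'a fls) = fls_X ^ nat e" by (simp add: power_int_def)
    also have "\<dots> = fls_X_intpow (int (nat e))" by (rule fls_X_power_conv_shift_1)
    finally show ?thesis using True by simp
  next
    case False
    then have "(fls_X powi e :: 'a fls) = fls_X_inv ^ nat (- e)"
      by (simp only: power_int_def fls_inverse_X if_False)
    also have "\<dots> = fls_shift (int (nat (- e))) 1" by (rule fls_X_inv_power_conv_shift_1)
    finally show ?thesis using False by simp
  qed
  have eq: "(fls_const c * fls_X) powi e = fls_const (c powi e) * fls_X_intpow e"
    by (simp only: power_int_mult_distrib const X)
  show ?thesis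
    unfolding eq by (rule finite_subset[of _ "{e}"]) auto
qed

lemma finite_support_qpoch:
  fixes a b :: "'a::field"
  shows "finite {k. fls_nth (qpoch (fls_const a / fls_X) (fls_const b) n) k \<noteq> 0}"
proof (induction n)
  case 0
  then show ?case using finite_support_const[of "1::'a"] by (simp add: qpoch_def)
next
  case (Suc n)
  have "fls_const a / fls_X * fls_const b ^ n = fls_const a * fls_X_inv * fls_const (b ^ n)"
    by (simp only: divide_inverse fls_inverse_X fls_const_power)
  also have "\<dots> = fls_const (a * b ^ n) * fls_X_inv"
    by (simp only: fls_const_mult_const[symmetric] mult.commute mult.left_commute)
  finally have eq: "fls_const a / fls_X * fls_const b ^ n = fls_const (a * b ^ n) * fls_X_inv" .
  have "finite {k. fls_nth (1 - fls_const a / fls_X * fls_const b ^ n) k \<noteq> 0}"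
    unfolding eq by (rule finite_subset[of _ "{0, - 1}"]) auto
  from finite_support_mult[OF Suc this] show ?case
    by (simp add: qpoch_def)
qed

end

theory Submission
  imports Defs
begin

text \<open>
  The functional \<open>Lz\<close> vanishes on the multiples of \<open>1 + z + z\<^sup>2\<close>. By the \<open>q\<close>-binomial theorem
  the left-hand side is \<open>Lz\<close> of a monomial times \<open>\<Prod>i = -N..M. 1 + y q\<^sup>i\<close> with \<open>y = \<epsilon>z\<close>,
  \<open>M = m + (s - 1)/2\<close> and \<open>N = n - (s + 1)/2\<close>. Modulo \<open>1 + z + z\<^sup>2\<close> the factors for \<open>i\<close> and \<open>-i\<close>
  combine to \<open>y q\<^bsup>-i\<^esup> (1 - \<epsilon>q\<^sup>i + q\<^bsup>2i\<^esup>) = y q\<^bsup>-i\<^esup> (1 + \<epsilon>q\<^bsup>3i\<^esup>) / (1 + \<epsilon>q\<^sup>i)\<close>; the factors for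
  \<open>-N \<le> i < -M\<close> and \<open>i = 0\<close> remain.
\<close>

section \<open>Shifted factorials, Gaussian binomials and the \<open>q\<close>-binomial
  theorem\<close>

lemma qpoch_0: "qpoch a b 0 = 1"
  by (simp add: qpoch_def)

lemma qpoch_Suc: "qpoch a b (Suc n) = qpoch a b n * (1 - a * b ^ n)"
  by (simp add: qpoch_def)

lemma qpoch_self_nonzero:
  fixes b :: "'a::field"
  assumes "\<And>i. i > 0 \<Longrightarrow> b ^ i \<noteq> 1"
  shows "qpoch b b n \<noteq> 0"
proof -
  have "1 - b * b ^ i \<noteq> 0" for i
    using assms[of "Suc i"] by auto
  then show ?thesis
    by (simp add: qpoch_def)
qed

lemma qbinom_of_nat:
  "j \<le> n \<Longrightarrow> qbinom b (int n) (int j) = qpoch b b n / (qpoch b b j * qpoch b b (n - j))"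
  by (simp add: qbinom_def nat_diff_distrib flip: of_nat_diff)

lemma qbinom_0:
  fixes b :: "'a::field"
  assumes "\<And>i. i > 0 \<Longrightarrow> b ^ i \<noteq> 1"
  shows "qbinom b (int n) 0 = 1"
  using qpoch_self_nonzero[OF assms] qbinom_of_nat[of 0 n b] by (simp add: qpoch_0)

text \<open>After clearing denominators this is the splitting 1 - b^(n+1) = (1 - b^(n-j)) + b^(n-j)
  (1 - b^(j+1)). All denominators are nonzero because \<open>b\<close> is not a root of
  unity.\<close>

lemma qbinom_pascal:
  fixes b :: "'a::field"
  assumes nz: "\<And>i. i > 0 \<Longrightarrow> b ^ i \<noteq> 1" and "j \<le> n"
  shows "qbinom b (int (Suc n)) (int (Suc j)) =
    qbinom b (int n) (int (Suc j)) + b ^ (n - j) * qbinom b (int n) (int j)"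
\<comment> \<open>For \<open>j = n\<close> the first term on the right is 0 by the default clause of
  \<open>qbinom\<close>, not by the factorial formula.\<close>
proof (cases "j = n")
  case True
  then show ?thesis
    using qpoch_self_nonzero[OF nz]
    by (simp add: qbinom_of_nat qpoch_0 del: of_nat_Suc) (simp add: qbinom_def)
next
  case False
  with \<open>j \<le> n\<close> obtain r where r: "n = j + Suc r"
    using less_imp_Suc_add[of j n] by auto
  have P: "qpoch b b i \<noteq> 0" for i
    by (rule qpoch_self_nonzero[OF nz])
  have f: "1 - b * b ^ i \<noteq> 0" for i
    using nz[of "Suc i"] by auto
  have a: "qbinom b (int (Suc n)) (int (Suc j)) =
      qpoch b b n * (1 - b * b ^ n) / (qpoch b b j * (1 - b * b ^ j) * (qpoch b b r * (1 - b * b ^ r)))"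
    using r by (simp add: qbinom_of_nat qpoch_Suc del: of_nat_Suc of_nat_add)
  have b: "qbinom b (int n) (int (Suc j)) =
      qpoch b b n / (qpoch b b j * (1 - b * b ^ j) * qpoch b b r)"
    using r by (simp add: qbinom_of_nat qpoch_Suc del: of_nat_Suc of_nat_add)
  have c: "qbinom b (int n) (int j) =
      qpoch b b n / (qpoch b b j * (qpoch b b r * (1 - b * b ^ r)))"
    using r by (simp add: qbinom_of_nat qpoch_Suc del: of_nat_Suc of_nat_add)
  have d: "1 - b * b ^ n = (1 - b * b ^ r) + b ^ (n - j) * (1 - b * b ^ j)"
    using r by (simp add: power_add algebra_simps)
  have "p * (v + w * u) / (A * u * (B * v)) = p / (A * u * B) + w * (p / (A * (B * v)))"
    if "A \<noteq> 0" "B \<noteq> 0" "u \<noteq> 0" "v \<noteq> 0" for p u v w A B :: 'a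
    using that by (simp add: divide_simps) (simp add: algebra_simps)
  from this[OF P P f f] show ?thesis
    unfolding a b c d .
qed

text \<open>Induction on \<open>n\<close>: multiplying by the new factor
  \<open>1 + x * b ^ n\<close> adds a copy of the sum with \<open>j\<close> shifted by one, and
  Pascal's rule merges the two. The exponent fits because C(j+1, 2) = j + C(j, 2).\<close>

lemma qbinomial_theorem:
  fixes b x :: "'a::field"
  assumes nz: "\<And>i. i > 0 \<Longrightarrow> b ^ i \<noteq> 1"
  shows "(\<Prod>i<n. 1 + x * b ^ i) = (\<Sum>j\<le>n. b ^ (j choose 2) * x ^ j * qbinom b (int n) (int j))"
proof (induction n)
  case 0
  show ?case
    using qbinom_0[OF nz, of 0] by (simp add: binomial_eq_0)
next
  case (Suc n)
  let ?t = "\<lambda>n j. b ^ (j choose 2) * x ^ j * qbinom b (int n) (int j)"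
  have step: "?t n (Suc j) + x * b ^ n * ?t n j = ?t (Suc n) (Suc j)" if "j \<le> n" for j
  proof -
    have "(Suc j choose 2) = j + (j choose 2)"
      by (simp add: numeral_2_eq_2)
    moreover have "b ^ n = b ^ j * b ^ (n - j)"
      using that by (simp flip: power_add)
    ultimately show ?thesis
      using qbinom_pascal[OF nz that] by (simp add: power_add algebra_simps)
  qed
  have top: "?t n (Suc n) = 0"
    by (simp add: qbinom_def)
  have "(\<Prod>i<Suc n. 1 + x * b ^ i) = (\<Sum>j\<le>n. ?t n j) + (\<Sum>j\<le>n. x * b ^ n * ?t n j)"
    unfolding prod.lessThan_Suc Suc.IH
    by (simp only: distrib_left mult_1_right sum_distrib_left[symmetric] mult.commute[of _ "x * b ^ n"])
  \<comment> \<open>Appending the vanishing term \<open>j = n + 1\<close> and then splitting off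
    \<open>j = 0\<close> aligns this sum, with index \<open>Suc j\<close>, with the shifted
    copy.\<close>
  also have "(\<Sum>j\<le>n. ?t n j) = (\<Sum>j\<le>Suc n. ?t n j)"
    using top by simp
  also have "\<dots> = ?t n 0 + (\<Sum>j\<le>n. ?t n (Suc j))"
    by (rule sum.atMost_Suc_shift)
  also have "\<dots> + (\<Sum>j\<le>n. x * b ^ n * ?t n j) = ?t n 0 + (\<Sum>j\<le>n. ?t (Suc n) (Suc j))"
  proof -
    have "(\<Sum>j\<le>n. ?t n (Suc j)) + (\<Sum>j\<le>n. x * b ^ n * ?t n j) = (\<Sum>j\<le>n. ?t (Suc n) (Suc j))"
      unfolding sum.distrib[symmetric] by (rule sum.cong) (simp_all only: step atMost_iff)
    then show ?thesis
      by (simp only: add.assoc)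
  qed
  also have "?t n 0 = ?t (Suc n) 0"
    using qbinom_0[OF nz, of n] qbinom_0[OF nz, of "Suc n"] by simp
  also have "?t (Suc n) 0 + (\<Sum>j\<le>n. ?t (Suc n) (Suc j)) = (\<Sum>j\<le>Suc n. ?t (Suc n) j)"
    by (rule sum.atMost_Suc_shift[symmetric])
  finally show ?case .
qed

section \<open>Laurent polynomials, on which \<open>Lz\<close> is additive\<close>

definition laurent_poly :: "'a::zero fls \<Rightarrow> bool"
  where "laurent_poly f \<longleftrightarrow> finite {k. fls_nth f k \<noteq> 0}"

lemma laurent_poly_mult:
  fixes f g :: "'a::semiring_0 fls"
  shows "laurent_poly f \<Longrightarrow> laurent_poly g \<Longrightarrow> laurent_poly (f * g)"
  unfolding laurent_poly_def by (rule finite_support_mult)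

lemma laurent_poly_const: "laurent_poly (fls_const c)"
  unfolding laurent_poly_def by (rule finite_support_const)

lemma laurent_poly_1: "laurent_poly 1"
  using laurent_poly_const[of 1] by simp

lemma laurent_poly_powi:
  fixes c :: "'a::field"
  shows "laurent_poly ((fls_const c * fls_X) powi e)"
  unfolding laurent_poly_def by (rule finite_support_powi)

lemma laurent_poly_power:
  fixes f :: "'a::semiring_1 fls"
  assumes "laurent_poly f"
  shows "laurent_poly (f ^ n)"
  by (induction n) (auto intro: laurent_poly_1 laurent_poly_mult assms)

lemma laurent_poly_X: "laurent_poly (fls_X :: 'a::field fls)"
  using laurent_poly_powi[of 1 1] by simp

lemma laurent_poly_add:
  fixes f g :: "'a::monoid_add fls"
  assumes "laurent_poly f" "laurent_poly g"
  shows "laurent_poly (f + g)"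
  unfolding laurent_poly_def
  by (rule finite_subset[OF _ finite_UnI[OF assms[unfolded laurent_poly_def]]]) auto

lemma laurent_poly_qpoch:
  fixes a b :: "'a::field"
  shows "laurent_poly (qpoch (fls_const a / fls_X) (fls_const b) n)"
  unfolding laurent_poly_def by (rule finite_support_qpoch)

lemma Lz_superset:
  assumes "finite S" "{k. fls_nth f k \<noteq> 0} \<subseteq> S"
  shows "Lz f = (\<Sum>k\<in>S. of_int (Legendre k 3) * fls_nth f k)"
  unfolding Lz_def using assms by (intro sum.mono_neutral_left) auto

lemma Lz_add:
  assumes "laurent_poly f" "laurent_poly g"
  shows "Lz (f + g) = Lz f + Lz g"
proof -
  \<comment> \<open>Cancellation can make the support of \<open>f + g\<close> smaller than this
    union, so all three values of \<open>Lz\<close> are computed over the common finite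
    superset.\<close>
  let ?S = "{k. fls_nth f k \<noteq> 0} \<union> {k. fls_nth g k \<noteq> 0}"
  have S: "finite ?S"
    using assms by (simp add: laurent_poly_def)
  then show ?thesis
    by (subst (1 2 3) Lz_superset[OF S]) (auto simp: distrib_left sum.distrib)
qed

lemma Lz_0: "Lz 0 = 0"
  by (simp add: Lz_def)

lemma laurent_poly_sum:
  fixes f :: "'b \<Rightarrow> 'a::comm_monoid_add fls"
  assumes "\<And>i. i \<in> A \<Longrightarrow> laurent_poly (f i)"
  shows "laurent_poly (sum f A)"
  using assms
  by (induction A rule: infinite_finite_induct)
    (auto intro: laurent_poly_add simp: laurent_poly_def[of 0])

lemma Lz_sum:
  assumes "\<And>i. i \<in> A \<Longrightarrow> laurent_poly (f i)"
  shows "Lz (sum f A) = (\<Sum>i\<in>A. Lz (f i))"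
  using assms
  by (induction A rule: infinite_finite_induct) (auto simp: Lz_0 Lz_add laurent_poly_sum)

lemma Lz_const_mult:
  fixes f :: "'a::field fls"
  shows "Lz (fls_const c * f) = c * Lz f"
proof (cases "c = 0")
  case False
  then show ?thesis
    by (simp add: Lz_def sum_distrib_left mult.left_commute)
qed (simp add: Lz_0)

section \<open>The kernel of \<open>Lz\<close> and congruence modulo 1 + z + z^2\<close>

lemma Lz_mult_X:
  "Lz (f * fls_X) = (\<Sum>k | fls_nth f k \<noteq> 0. of_int (Legendre (k + 1) 3) * fls_nth f k)"
  unfolding Lz_def
  by (rule sum.reindex_bij_witness[of _ "\<lambda>k. k + 1" "\<lambda>k. k - 1"])
    (auto simp: fls_X_times_conv_shift add.commute)

text \<open>Multiplication by z shifts the argument of the Legendre symbol by one, and among three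
  consecutive integers the symbol takes the values 0, 1, -1 once each.\<close>

lemma Lz_mult_cyclotomic:
  fixes f :: "'a::field fls"
  assumes f: "laurent_poly f"
  shows "Lz (f * (1 + fls_X + fls_X\<^sup>2)) = 0"
proof -
  have fX: "laurent_poly (f * fls_X)"
    by (intro laurent_poly_mult f laurent_poly_X)
  have leg: "Legendre k 3 + Legendre (k + 1) 3 + Legendre (k + 2) 3 = 0" for k
    unfolding Legendre_3 by presburger
  \<comment> \<open>One shift leaves a sum over the support of \<open>f * fls_X\<close>; reindexing
    by the second shift brings it back to the support of \<open>f\<close>.\<close>
  have X2: "Lz (f * fls_X * fls_X)
      = (\<Sum>k | fls_nth f k \<noteq> 0. of_int (Legendre (k + 2) 3) * fls_nth f k)"
    unfolding Lz_mult_X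
    by (rule sum.reindex_bij_witness[of _ "\<lambda>k. k + 1" "\<lambda>k. k - 1"])
      (auto simp: fls_X_times_conv_shift add.commute)
  have "f * (1 + fls_X + fls_X\<^sup>2) = f + f * fls_X + f * fls_X * fls_X"
    by (simp add: algebra_simps power2_eq_square)
  then have "Lz (f * (1 + fls_X + fls_X\<^sup>2)) = Lz f + Lz (f * fls_X) + Lz (f * fls_X * fls_X)"
    by (simp add: Lz_add laurent_poly_add laurent_poly_mult laurent_poly_X f fX)
  also have "\<dots> = (\<Sum>k | fls_nth f k \<noteq> 0.
      of_int (Legendre k 3 + Legendre (k + 1) 3 + Legendre (k + 2) 3) * fls_nth f k)"
    unfolding X2 unfolding Lz_mult_X unfolding Lz_def
    by (simp only: of_int_add distrib_right sum.distrib)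
  finally show ?thesis
    by (simp only: leg) simp
qed

text \<open>The cofactor must be a Laurent polynomial: 1 + z + z^2 is invertible among Laurent
  series, so with arbitrary cofactors any two series would be congruent.\<close>

definition cyc_cong :: "'a::field fls \<Rightarrow> 'a fls \<Rightarrow> bool"
  where "cyc_cong f g \<longleftrightarrow> (\<exists>h. laurent_poly h \<and> f = g + h * (1 + fls_X + fls_X\<^sup>2))"

lemma cyc_cong_refl: "cyc_cong f f"
  unfolding cyc_cong_def by (intro exI[of _ 0]) (simp add: laurent_poly_def)

lemma cyc_cong_trans:
  assumes "cyc_cong f g" "cyc_cong g h"
  shows "cyc_cong f h"
proof -
  obtain u v where "laurent_poly u" "f = g + u * (1 + fls_X + fls_X\<^sup>2)"
    and "laurent_poly v" "g = h + v * (1 + fls_X + fls_X\<^sup>2)"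
    using assms unfolding cyc_cong_def by blast
  then show ?thesis
    unfolding cyc_cong_def
    by (intro exI[of _ "v + u"]) (simp only: laurent_poly_add distrib_right add.assoc)
qed

lemma cyc_cong_mult:
  assumes "cyc_cong f g" "laurent_poly c"
  shows "cyc_cong (c * f) (c * g)"
proof -
  obtain u where "laurent_poly u" "f = g + u * (1 + fls_X + fls_X\<^sup>2)"
    using assms unfolding cyc_cong_def by blast
  with assms(2) show ?thesis
    unfolding cyc_cong_def
    by (intro exI[of _ "c * u"])
      (simp only: laurent_poly_mult distrib_left[of c] mult.assoc)
qed

lemma Lz_cyc_cong:
  assumes "cyc_cong f g" "laurent_poly g"
  shows "Lz f = Lz g"
proof -
  obtain h where h: "laurent_poly h" "f = g + h * (1 + fls_X + fls_X\<^sup>2)"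
    using assms(1) unfolding cyc_cong_def by blast
  have "laurent_poly (h * (1 + fls_X + fls_X\<^sup>2))"
    by (intro laurent_poly_mult laurent_poly_add laurent_poly_1 laurent_poly_X
        laurent_poly_power h)
  then show ?thesis
    unfolding h(2) by (simp only: Lz_add assms(2) Lz_mult_cyclotomic h(1) add_0_right)
qed

lemma fls_X_powi: "(fls_X powi e :: 'a::field fls) = fls_X_intpow e"
proof (cases "e \<ge> 0")
  case True
  then have "(fls_X powi e :: 'a fls) = fls_X ^ nat e"
    by (simp add: power_int_def)
  also have "\<dots> = fls_X_intpow (int (nat e))"
    by (rule fls_X_power_conv_shift_1)
  finally show ?thesis
    using True by simp
next
  case False
  then have "(fls_X powi e :: 'a fls) = fls_X_inv ^ nat (- e)"
    by (simp only: power_int_def fls_inverse_X if_False)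
  also have "\<dots> = fls_shift (int (nat (- e))) 1"
    by (rule fls_X_inv_power_conv_shift_1)
  finally show ?thesis
    using False by simp
qed

lemma Lz_powi:
  fixes c :: "'a::field"
  shows "Lz ((fls_const c * fls_X) powi e) = c powi e * of_int (Legendre e 3)"
proof -
  have "Lz ((fls_const c * fls_X) powi e) = c powi e * Lz (fls_X_intpow e :: 'a fls)"
    by (simp only: power_int_mult_distrib fls_const_power_int[symmetric] fls_X_powi Lz_const_mult)
  also have "Lz (fls_X_intpow e :: 'a fls) = of_int (Legendre e 3)"
    by (subst Lz_superset[of "{e}"]) auto
  finally show ?thesis .
qed

section \<open>Reduction of the product modulo 1 + z + z^2\<close>

lemma cyc_cong_pair:
  fixes \<epsilon> b :: "'a::field"
  assumes "\<epsilon>\<^sup>2 = 1" and "b \<noteq> 0" and nz: "1 + \<epsilon> * b \<noteq> 0"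
  shows "cyc_cong
    ((1 + fls_const \<epsilon> * fls_X * fls_const b) * (1 + fls_const \<epsilon> * fls_X * fls_const (inverse b)))
    (fls_const (inverse b * ((1 + \<epsilon> * b ^ 3) / (1 + \<epsilon> * b))) * (fls_const \<epsilon> * fls_X))"
proof -
  \<comment> \<open>A sum of two cubes, since \<epsilon>^3 = \<epsilon>.\<close>
  have "1 + \<epsilon> * b ^ 3 = (1 + \<epsilon> * b) * (1 - \<epsilon> * b + b\<^sup>2)"
    using assms(1) by (simp add: algebra_simps power2_eq_square power3_eq_cube)
  then have quot: "(1 + \<epsilon> * b ^ 3) / (1 + \<epsilon> * b) = 1 - \<epsilon> * b + b\<^sup>2"
    using nz by simp
  have coeff: "inverse b * (1 - \<epsilon> * b + b\<^sup>2) = b + inverse b - \<epsilon>"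
    using \<open>b \<noteq> 0\<close> by (simp add: field_simps power2_eq_square)
  let ?E = "fls_const \<epsilon>" and ?B = "fls_const b" and ?B' = "fls_const (inverse b)"
  have E: "?E * ?E = 1"
    using assms(1) by (simp add: fls_const_mult_const power2_eq_square)
  have B: "?B * ?B' = 1"
    using \<open>b \<noteq> 0\<close> by (simp add: fls_const_mult_const)
  have "(1 + ?E * fls_X * ?B) * (1 + ?E * fls_X * ?B')
      = 1 + ?E * fls_X * (?B + ?B') + (?E * ?E) * (?B * ?B') * fls_X\<^sup>2"
    by (simp add: algebra_simps power2_eq_square)
  also have "\<dots> = 1 + ?E * fls_X * (?B + ?B') + fls_X\<^sup>2"
    by (simp only: E B mult_1_left)
  \<comment> \<open>Taking 1 + z + z^2 away once leaves only a multiple of z. The surplus -z becomes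
    -\<epsilon> times \<epsilon>z, which accounts for the term \<open>- ?E\<close> in the
    coefficient.\<close>
  also have "\<dots> = (?B + ?B' - ?E) * (?E * fls_X) + 1 * ((?E * ?E) * fls_X + 1 + fls_X\<^sup>2)"
    by (simp add: algebra_simps)
  also have "\<dots> = (?B + ?B' - ?E) * (?E * fls_X) + 1 * (1 + fls_X + fls_X\<^sup>2)"
    by (simp only: E mult_1_left add.commute[of fls_X])
  also have "?B + ?B' - ?E = fls_const (b + inverse b - \<epsilon>)"
    by (simp only: fls_plus_const fls_minus_const)
  finally have "(1 + ?E * fls_X * ?B) * (1 + ?E * fls_X * ?B') =
      fls_const (b + inverse b - \<epsilon>) * (?E * fls_X) + 1 * (1 + fls_X + fls_X\<^sup>2)" .
  then show ?thesis
    unfolding quot coeff cyc_cong_def using laurent_poly_1 by blast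
qed

text \<open>The exponents run over -M..M. Exponent 0 supplies \<open>1 + y\<close>, and each pair i,
  -i contributes y b^(-i) (1 + \<epsilon>b^(3i)) / (1 + \<epsilon>b^i) by
  \<open>cyc_cong_pair\<close>; the powers b^(-i) multiply to a triangular exponent.\<close>

lemma centred_prod_cong:
  fixes \<epsilon> b :: "'a::field"
  defines "y \<equiv> fls_const \<epsilon> * fls_X"
  assumes \<epsilon>: "\<epsilon>\<^sup>2 = 1" and b: "b \<noteq> 0" and nz: "\<And>i. i > 0 \<Longrightarrow> 1 + \<epsilon> * b ^ i \<noteq> 0"
  shows "cyc_cong (\<Prod>i<Suc (M + M). 1 + y * fls_const (b powi (int i - int M)))
    (fls_const (inverse b ^ (M * (M + 1) div 2)
      * (qpoch (- \<epsilon> * b ^ 3) (b ^ 3) M / qpoch (- \<epsilon> * b) b M)) * (y ^ M * (1 + y)))"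
proof (induction M)
  case 0
  show ?case
    by (simp add: qpoch_0 cyc_cong_refl)
next
  case (Suc M)
  let ?f = "\<lambda>e. 1 + y * fls_const (b powi e)"
  let ?P = "\<Prod>i<Suc (M + M). ?f (int i - int M)"
  let ?C = "\<lambda>M. qpoch (- \<epsilon> * b ^ 3) (b ^ 3) M / qpoch (- \<epsilon> * b) b M"
  let ?c = "inverse (b ^ Suc M) * ((1 + \<epsilon> * (b ^ Suc M) ^ 3) / (1 + \<epsilon> * b ^ Suc M))"
  let ?R = "fls_const (inverse b ^ (M * (M + 1) div 2) * ?C M) * (y ^ M * (1 + y))"
  have y: "laurent_poly y"
    unfolding y_def by (intro laurent_poly_mult laurent_poly_const laurent_poly_X)
  have pair: "?f (int (Suc M)) * ?f (- int (Suc M))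
      = (1 + y * fls_const (b ^ Suc M)) * (1 + y * fls_const (inverse (b ^ Suc M)))"
    by (simp only: power_int_minus power_int_of_nat)
  \<comment> \<open>Passing from \<open>M\<close> to \<open>Suc M\<close> adds one factor at each
    end: the last is split off directly, the first by an index shift that recentres the remaining
    product.\<close>
  have "(\<Prod>i<Suc (Suc M + Suc M). ?f (int i - int (Suc M)))
      = ?f (int (Suc M)) * ?f (- int (Suc M)) * ?P"
  proof -
    have "(\<Prod>i<Suc (Suc M + Suc M). ?f (int i - int (Suc M)))
        = (\<Prod>i<Suc (Suc (M + M)). ?f (int i - int (Suc M))) * ?f (int (Suc M))"
      by simp
    also have "(\<Prod>i<Suc (Suc (M + M)). ?f (int i - int (Suc M))) = ?f (- int (Suc M)) * ?P"
      unfolding prod.lessThan_Suc_shift[of _ "Suc (M + M)"] by simp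
    finally show ?thesis
      by (simp only: ac_simps)
  qed
  also have "cyc_cong \<dots> (?f (int (Suc M)) * ?f (- int (Suc M)) * ?R)"
    by (intro cyc_cong_mult Suc.IH laurent_poly_mult laurent_poly_add laurent_poly_1
        laurent_poly_const y)
  finally have 1: "cyc_cong (\<Prod>i<Suc (Suc M + Suc M). ?f (int i - int (Suc M)))
      (?f (int (Suc M)) * ?f (- int (Suc M)) * ?R)" .
  \<comment> \<open>The induction hypothesis was multiplied by the new pair; now the congruence for
    the pair is multiplied by \<open>?R\<close>, and transitivity joins the two.\<close>
  have "cyc_cong (?f (int (Suc M)) * ?f (- int (Suc M))) (fls_const ?c * y)"
    unfolding pair unfolding y_def
    by (rule cyc_cong_pair[OF \<epsilon>]) (use b nz[of "Suc M"] in simp_all)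
  then have "cyc_cong (?R * (?f (int (Suc M)) * ?f (- int (Suc M)))) (?R * (fls_const ?c * y))"
    by (intro cyc_cong_mult laurent_poly_mult laurent_poly_add laurent_poly_1
        laurent_poly_const laurent_poly_power y)
  then have 2: "cyc_cong (\<Prod>i<Suc (Suc M + Suc M). ?f (int i - int (Suc M)))
      (?R * (fls_const ?c * y))"
    by (rule cyc_cong_trans[OF 1[unfolded mult.commute[of _ ?R]]])
  have tri: "Suc M * (Suc M + 1) div 2 = M * (M + 1) div 2 + Suc M"
    by simp
  have C: "?C (Suc M) = ?C M * ((1 + \<epsilon> * (b ^ Suc M) ^ 3) / (1 + \<epsilon> * b ^ Suc M))"
  proof -
    have "b ^ 3 * (b ^ 3) ^ M = (b ^ Suc M) ^ 3"
      by (simp only: power_mult_distrib power_Suc flip: power_mult) (simp only: mult.commute)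
    then have "1 - - \<epsilon> * b ^ 3 * (b ^ 3) ^ M = 1 + \<epsilon> * (b ^ Suc M) ^ 3"
      by (simp only: mult.assoc mult_minus_left diff_minus_eq_add)
    moreover have "1 - - \<epsilon> * b * b ^ M = 1 + \<epsilon> * b ^ Suc M"
      by simp
    ultimately show ?thesis
      by (simp only: qpoch_Suc times_divide_times_eq)
  qed
  have "?R * (fls_const ?c * y)
      = fls_const (inverse b ^ (M * (M + 1) div 2) * ?C M * ?c) * (y ^ Suc M * (1 + y))"
    by (simp only: fls_const_mult_const[symmetric] power_Suc ac_simps)
  also have "inverse b ^ (M * (M + 1) div 2) * ?C M * ?c
      = inverse b ^ (Suc M * (Suc M + 1) div 2) * ?C (Suc M)"
    unfolding tri C by (simp only: power_add power_inverse ac_simps)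
  finally have 3: "?R * (fls_const ?c * y)
      = fls_const (inverse b ^ (Suc M * (Suc M + 1) div 2) * ?C (Suc M)) * (y ^ Suc M * (1 + y))" .
  show ?case
    using 2 unfolding 3 .
qed

text \<open>Induction on \<open>N\<close> from the symmetric case \<open>N = M\<close>. A further
  factor 1 + y b^(-N-1) has no partner and is rewritten exactly as b^(-N-1) y (1 + b^(N+1)/y); as
  1/y = \<epsilon>/z, the bracket is the next factor of the shifted factorial in 1/z.\<close>

lemma prod_cong:
  fixes \<epsilon> b :: "'a::field"
  defines "y \<equiv> fls_const \<epsilon> * fls_X"
  assumes \<epsilon>: "\<epsilon>\<^sup>2 = 1" and b: "b \<noteq> 0" and nz: "\<And>i. i > 0 \<Longrightarrow> 1 + \<epsilon> * b ^ i \<noteq> 0"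
    and "M \<le> N"
  shows "cyc_cong (\<Prod>i<Suc (M + N). 1 + y * fls_const (b powi (int i - int N)))
    (fls_const (inverse b ^ (N * (N + 1) div 2)
      * (qpoch (- \<epsilon> * b ^ 3) (b ^ 3) M / qpoch (- \<epsilon> * b) b M))
      * (y ^ N * (1 + y) * qpoch (fls_const (- \<epsilon> * b ^ Suc M) / fls_X) (fls_const b) (N - M)))"
  using \<open>M \<le> N\<close>
proof (induction N rule: dec_induct)
  case base
  show ?case
    using centred_prod_cong[OF \<epsilon> b nz, of M] by (simp add: y_def qpoch_0)
next
  case (step N)
  let ?f = "\<lambda>e. 1 + y * fls_const (b powi e)"
  let ?P = "\<lambda>N. \<Prod>i<Suc (M + N). ?f (int i - int N)"
  let ?C = "qpoch (- \<epsilon> * b ^ 3) (b ^ 3) M / qpoch (- \<epsilon> * b) b M"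
  let ?a = "fls_const (- \<epsilon> * b ^ Suc M) / fls_X"
  let ?q = "qpoch ?a (fls_const b)"
  have y: "laurent_poly y"
    unfolding y_def by (intro laurent_poly_mult laurent_poly_const laurent_poly_X)
  have "?P (Suc N) = ?f (- int (Suc N)) * ?P N"
    using prod.lessThan_Suc_shift[of "\<lambda>i. ?f (int i - int (Suc N))" "Suc (M + N)"] by simp
  also have "cyc_cong \<dots> (?f (- int (Suc N)) * (fls_const (inverse b ^ (N * (N + 1) div 2) * ?C)
      * (y ^ N * (1 + y) * ?q (N - M))))"
    by (intro cyc_cong_mult step.IH laurent_poly_mult laurent_poly_add laurent_poly_1
        laurent_poly_const y)
  finally have 1: "cyc_cong (?P (Suc N))
      (?f (- int (Suc N)) * (fls_const (inverse b ^ (N * (N + 1) div 2) * ?C)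
      * (y ^ N * (1 + y) * ?q (N - M))))" .
  have E: "fls_const \<epsilon> * fls_const \<epsilon> = 1"
    using \<epsilon> by (simp add: power2_eq_square)
  have "inverse b ^ Suc N * b ^ Suc N = 1"
    using b by (simp del: power_Suc flip: power_mult_distrib)
  then have B: "fls_const (inverse b ^ Suc N) * fls_const (b ^ Suc N) = 1"
    by (simp del: power_Suc)
  \<comment> \<open>The last factor of \<open>?q (Suc N - M)\<close> has index \<open>N - M\<close>,
    so its power of \<open>b\<close> is exactly \<open>Suc N\<close>, matching the new factor of the
    product.\<close>
  have "b ^ Suc M * b ^ (N - M) = b ^ Suc N"
    using step.hyps by (simp flip: power_add)
  then have "- \<epsilon> * b ^ Suc M * b ^ (N - M) = - 1 * (\<epsilon> * b ^ Suc N)"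
    by simp
  then have "?a * fls_const b ^ (N - M) = fls_const (- 1 * (\<epsilon> * b ^ Suc N)) / fls_X"
    by (simp only: times_divide_eq_left fls_const_mult_const flip: fls_const_power)
  also have "\<dots> = - (fls_const \<epsilon> * fls_const (b ^ Suc N) / fls_X)"
    by (simp only: fls_const_mult_const[symmetric] fls_const_1) simp
  finally have "?a * fls_const b ^ (N - M) = - (fls_const \<epsilon> * fls_const (b ^ Suc N) / fls_X)" .
  \<comment> \<open>The exact rewriting of the new factor, with e = \<epsilon>, x = z, c = b^(N+1)
    and c' its inverse; e * e = 1 replaces 1/(e * x) by e/x.\<close>
  moreover have "c' * (e * x) * (1 - - (e * c / x)) = 1 + (e * x) * c'"
    if "e * e = 1" "c' * c = 1" "x \<noteq> 0" for e c c' x :: "'a fls"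
  proof -
    have "c' * (e * x) * (1 - - (e * c / x)) = (e * x) * c' + (e * e) * (c' * c)"
      using \<open>x \<noteq> 0\<close> by (simp add: field_simps)
    then show ?thesis
      using that by simp
  qed
  note this[OF E B fls_X_nonzero]
  ultimately have f: "?f (- int (Suc N))
      = fls_const (inverse b ^ Suc N) * y * (1 - ?a * fls_const b ^ (N - M))"
    by (simp only: y_def power_int_minus power_int_of_nat power_inverse)
  have tri: "Suc N * (Suc N + 1) div 2 = N * (N + 1) div 2 + Suc N"
    by simp
  have 2: "?f (- int (Suc N)) * (fls_const (inverse b ^ (N * (N + 1) div 2) * ?C)
      * (y ^ N * (1 + y) * ?q (N - M)))
    = fls_const (inverse b ^ (Suc N * (Suc N + 1) div 2) * ?C)
      * (y ^ Suc N * (1 + y) * ?q (Suc N - M))"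
    unfolding f tri Suc_diff_le[OF step.hyps(1)] qpoch_Suc
    by (simp only: power_add power_Suc[of y] fls_const_mult_const[symmetric] ac_simps)
  show ?case
    using 1 unfolding 2 .
qed

section \<open>The left-hand side as a value of \<open>Lz\<close>\<close>

lemma qpoch_fls_const: "qpoch (fls_const a) (fls_const b) i = fls_const (qpoch a b i)"
  for a b :: "'a::field"
proof -
  have one: "1 - fls_const c = fls_const (1 - c)" for c :: 'a
    by (simp only: fls_const_1[symmetric] fls_minus_const)
  show ?thesis
    by (induction i)
      (simp_all only: qpoch_0 qpoch_Suc one fls_const_power[symmetric] fls_const_mult_const fls_const_1)
qed

lemma qbinom_fls_const: "qbinom (fls_const b) n k = fls_const (qbinom b n k)"
  for b :: "'a::field"
  by (simp add: qbinom_def qpoch_fls_const fls_const_divide_const)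

lemma of_nat_choose_two: "2 * int (j choose 2) = int j * (int j - 1)"
proof (induction j)
  case 0
  show ?case
    by (simp add: binomial_eq_0)
next
  case (Suc j)
  have "(Suc j choose 2) = j + (j choose 2)"
    by (simp add: numeral_2_eq_2)
  with Suc.IH show ?case
    by (simp add: algebra_simps)
qed

text \<open>The odd \<open>s\<close> is written as \<open>2 * t - 1\<close>. The
  \<open>q\<close>-binomial theorem over the field of Laurent series expands the product; with j = n
  + k, the monomial y^(k+d) is sent by \<open>Lz\<close> to \<epsilon>^(k+d) times the Legendre
  symbol of k + d.\<close>

lemma qbinomial_sum_Lz:
  fixes \<epsilon> b :: "'a::field" and d t n m :: int
  defines "y \<equiv> fls_const \<epsilon> * fls_X"
  assumes b: "b \<noteq> 0" and nz: "\<And>i. i > 0 \<Longrightarrow> b ^ i \<noteq> 1" and \<epsilon>: "\<epsilon> \<noteq> 0" and nm: "n + m \<ge> 0"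
  shows "(\<Sum>k = - n..m. \<epsilon> powi (k + d) * of_int (Legendre (k + d) 3)
      * b powi ((k\<^sup>2 + (2 * t - 1) * k) div 2) * qbinom b (n + m) (n + k))
    = b powi (n * (n + 1) div 2 - t * n)
      * Lz (y powi (d - n) * (\<Prod>i<nat (n + m). 1 + y * fls_const (b powi (int i - (n - t)))))"
proof -
  let ?L = "nat (n + m)"
  let ?c = "\<lambda>j. b ^ (j choose 2) * b powi ((t - n) * int j) * qbinom b (int ?L) (int j)"
  let ?g = "\<lambda>k. \<epsilon> powi (k + d) * of_int (Legendre (k + d) 3)
      * b powi ((k\<^sup>2 + (2 * t - 1) * k) div 2) * qbinom b (n + m) (n + k)"
  have shift: "(\<Sum>j\<le>?L. g (int j - n)) = sum g {- n..m}" for g :: "int \<Rightarrow> 'a"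
    by (rule sum.reindex_bij_witness[of _ "\<lambda>k. nat (k + n)" "\<lambda>j. int j - n"]) (use nm in auto)
  have L: "int ?L = n + m"
    using nm by simp
  have y: "laurent_poly (y powi e)" for e
    unfolding y_def by (rule laurent_poly_powi)
  have y0: "y \<noteq> 0"
    using \<epsilon> by (simp add: y_def)
  have nzc: "fls_const b ^ i \<noteq> 1" if "i > 0" for i
    using nz[OF that] by (simp flip: fls_const_power)
  \<comment> \<open>Chosen so that the first factor of the product, with exponent t - n, is
    \<open>1 + ?x\<close>; each later factor raises the power of \<open>b\<close> by one.\<close>
  let ?x = "y * fls_const (b powi (t - n))"
  have "1 + y * fls_const (b powi (int i - (n - t))) = 1 + ?x * fls_const b ^ i" for i
  proof -
    have "b powi (int i - (n - t)) = b powi (t - n) * b ^ i"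
      using b power_int_add[of b "t - n" "int i"] by (simp add: algebra_simps)
    then show ?thesis
      by (simp only: fls_const_mult_const[symmetric] fls_const_power mult.assoc)
  qed
  then have "(\<Prod>i<?L. 1 + y * fls_const (b powi (int i - (n - t))))
      = (\<Sum>j\<le>?L. fls_const b ^ (j choose 2) * ?x ^ j * qbinom (fls_const b) (int ?L) (int j))"
    using qbinomial_theorem[OF nzc, of ?x ?L] by (simp only:)
  also have "\<dots> = (\<Sum>j\<le>?L. fls_const (?c j) * y powi int j)"
  proof (rule sum.cong)
    fix j
    have "?x ^ j = y powi int j * fls_const (b powi ((t - n) * int j))"
      by (simp only: power_mult_distrib power_int_of_nat power_int_mult fls_const_power)
    then show "fls_const b ^ (j choose 2) * ?x ^ j * qbinom (fls_const b) (int ?L) (int j)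
        = fls_const (?c j) * y powi int j"
      by (simp only: qbinom_fls_const fls_const_mult_const[symmetric] fls_const_power mult.assoc
          mult.commute[of _ "y powi int j"] mult.left_commute[of _ "y powi int j"])
  qed simp
  finally have P: "(\<Prod>i<?L. 1 + y * fls_const (b powi (int i - (n - t))))
      = (\<Sum>j\<le>?L. fls_const (?c j) * y powi int j)" .
  have "y powi (d - n) * (\<Prod>i<?L. 1 + y * fls_const (b powi (int i - (n - t))))
      = (\<Sum>j\<le>?L. fls_const (?c j) * y powi (int j - n + d))"
    unfolding P sum_distrib_left
  proof (rule sum.cong)
    fix j
    have "y powi (int j - n + d) = y powi (d - n) * y powi int j"
      using y0 power_int_add[of y "d - n" "int j"] by (simp add: algebra_simps)
    then show "y powi (d - n) * (fls_const (?c j) * y powi int j)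
        = fls_const (?c j) * y powi (int j - n + d)"
      by (simp only: mult.left_commute)
  qed simp
  then have "Lz (y powi (d - n) * (\<Prod>i<?L. 1 + y * fls_const (b powi (int i - (n - t)))))
      = Lz (\<Sum>j\<le>?L. fls_const (?c j) * y powi (int j - n + d))"
    by (rule arg_cong)
  also have "\<dots> = (\<Sum>j\<le>?L. Lz (fls_const (?c j) * y powi (int j - n + d)))"
    by (rule Lz_sum) (intro laurent_poly_mult laurent_poly_const y)
  also have "\<dots> = (\<Sum>j\<le>?L. ?c j * (\<epsilon> powi (int j - n + d) * of_int (Legendre (int j - n + d) 3)))"
    by (simp only: Lz_const_mult y_def Lz_powi)
  finally have Lz: "Lz (y powi (d - n) * (\<Prod>i<?L. 1 + y * fls_const (b powi (int i - (n - t)))))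
      = (\<Sum>j\<le>?L. ?c j * (\<epsilon> powi (int j - n + d) * of_int (Legendre (int j - n + d) 3)))" .
  have "b powi (n * (n + 1) div 2 - t * n)
      * Lz (y powi (d - n) * (\<Prod>i<?L. 1 + y * fls_const (b powi (int i - (n - t)))))
    = (\<Sum>j\<le>?L. ?g (int j - n))"
    unfolding Lz sum_distrib_left
  proof (rule sum.cong)
    fix j
    have nj: "n + (int j - n) = int j"
      by simp
    \<comment> \<open>The \<open>div 2\<close> in the exponents is exact: twice the exponent is
      j(j-1) + n(n+1) plus an even number, and its half separates into a constant, C(j, 2) and a
      part linear in \<open>j\<close>.\<close>
    have "even (n * (n + 1))"
      by simp
    then obtain v where v: "n * (n + 1) = 2 * v"
      by blast
    have "(int j - n)\<^sup>2 + (2 * t - 1) * (int j - n)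
        = int j * (int j - 1) + n * (n + 1) + 2 * ((t - n) * int j - t * n)"
      by (simp add: algebra_simps power2_eq_square)
    also have "\<dots> = 2 * ((v - t * n) + int (j choose 2) + (t - n) * int j)"
      unfolding v of_nat_choose_two[symmetric] by simp
    finally have "((int j - n)\<^sup>2 + (2 * t - 1) * (int j - n)) div 2
        = (n * (n + 1) div 2 - t * n) + int (j choose 2) + (t - n) * int j"
      unfolding v by simp
    then have "b powi (((int j - n)\<^sup>2 + (2 * t - 1) * (int j - n)) div 2)
        = b powi (n * (n + 1) div 2 - t * n) * b ^ (j choose 2) * b powi ((t - n) * int j)"
      by (simp only: power_int_add[OF disjI1[OF b]] power_int_of_nat)
    then show "b powi (n * (n + 1) div 2 - t * n)
        * (?c j * (\<epsilon> powi (int j - n + d) * of_int (Legendre (int j - n + d) 3)))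
      = ?g (int j - n)"
      unfolding L nj by (simp only: mult_ac)
  qed simp
  also have "\<dots> = sum ?g {- n..m}"
    by (rule shift)
  finally show ?thesis ..
qed

section \<open>Specialisation to the formal variable \<open>q\<close> and the proof of the
  theorem\<close>

lemma qvar_power: "qvar ^ i = Fract ([:0, 1:] ^ i) 1"
  by (induction i) (simp_all add: qvar_def One_fract_def)

lemma qvar_nonzero: "qvar \<noteq> 0"
  by (simp add: qvar_def Zero_fract_def eq_fract)

text \<open>By degree. This makes the Gaussian binomials well defined and, through squares, keeps 1
  + \<epsilon>q^i away from zero.\<close>

lemma qvar_power_neq_1:
  assumes "i > 0"
  shows "qvar ^ i \<noteq> 1"
proof
  assume "qvar ^ i = 1"
  then have "[:0, 1::rat:] ^ i = 1"
    by (simp add: qvar_power One_fract_def eq_fract)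
  then have "degree ([:0, 1::rat:] ^ i) = 0"
    by simp
  with assms show False
    by (simp add: degree_power_eq)
qed

theorem theorem1p1:
  fixes \<epsilon> :: qfield and d s n m :: int
  assumes "\<epsilon> \<in> {1, - 1}" and "d \<in> {0, 1, 2}" and "s < 0" and "odd s"
    and "n > 0" and "m > 0" and "(1 - s) div 2 \<le> m" and "m \<le> n - s"
  shows "(\<Sum>k = - n..m. \<epsilon> powi (k + d) * of_int (Legendre (k + d) 3)
            * qvar powi ((k\<^sup>2 + s * k) div 2) * qbinom qvar (n + m) (n + k))
    = qpoch (- \<epsilon> * qvar ^ 3) (qvar ^ 3) (nat (m + (s - 1) div 2))
        / qpoch (- \<epsilon> * qvar) qvar (nat (m + (s - 1) div 2))
      * Lz (fls_const (qvar powi ((1 - s\<^sup>2) div 8))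
            * (fls_const \<epsilon> * fls_X) powi (d - (s + 1) div 2)
            * (1 + fls_const \<epsilon> * fls_X)
            * qpoch (fls_const (- \<epsilon> * qvar powi (m + (s + 1) div 2)) / fls_X)
                (fls_const qvar) (nat (n - m - s)))"
proof -
  define t where "t = (s + 1) div 2"
  define M where "M = nat (m + t - 1)"
  define N where "N = nat (n - t)"
  define y where "y = fls_const \<epsilon> * fls_X"
  define C where "C = qpoch (- \<epsilon> * qvar ^ 3) (qvar ^ 3) M / qpoch (- \<epsilon> * qvar) qvar M"
  define G where "G = qpoch (fls_const (- \<epsilon> * qvar ^ Suc M) / fls_X) (fls_const qvar) (N - M)"
  have s: "s = 2 * t - 1"
    using \<open>odd s\<close> unfolding t_def by presburger
  \<comment> \<open>The lower bound on \<open>m\<close> says that m + t - 1 is nonnegative, the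
    upper bound that \<open>M \<le> N\<close>; since s < 0 gives t \<le> 0, also n - t > 0. Hence no
    \<open>nat\<close> truncates.\<close>
  have M: "int M = m + t - 1" and N: "int N = n - t" and "M \<le> N"
    using assms(3,5,7,8) unfolding M_def N_def s by auto
  have NM: "nat (n + m) = Suc (M + N)" "nat (n - m - s) = N - M"
    using M N s by linarith+
  have MM: "m + (s - 1) div 2 = int M" "m + (s + 1) div 2 = int (Suc M)" "(s + 1) div 2 = t"
    using M s by simp_all
  have \<epsilon>: "\<epsilon>\<^sup>2 = 1" "\<epsilon> \<noteq> 0"
    using assms(1) by auto
  \<comment> \<open>Otherwise squaring \<epsilon>q^i = -1 would give q^(2i) = 1.\<close>
  have nz: "1 + \<epsilon> * qvar ^ i \<noteq> 0" if "i > 0" for i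
  proof
    assume "1 + \<epsilon> * qvar ^ i = 0"
    then have "(\<epsilon> * qvar ^ i)\<^sup>2 = (- 1)\<^sup>2"
      by (simp only: add_eq_0_iff)
    then have "qvar ^ (i * 2) = 1"
      using \<epsilon> by (simp add: power_mult_distrib flip: power_mult)
    with qvar_power_neq_1[of "i * 2"] that show False
      by simp
  qed
  have y: "y \<noteq> 0"
    using \<epsilon>(2) by (simp add: y_def)
  have "(\<Sum>k = - n..m. \<epsilon> powi (k + d) * of_int (Legendre (k + d) 3)
            * qvar powi ((k\<^sup>2 + s * k) div 2) * qbinom qvar (n + m) (n + k))
    = qvar powi (n * (n + 1) div 2 - t * n)
      * Lz (y powi (d - n) * (\<Prod>i<Suc (M + N). 1 + y * fls_const (qvar powi (int i - int N))))"
    using qbinomial_sum_Lz[OF qvar_nonzero qvar_power_neq_1 \<epsilon>(2), of n m d t] assms(5,6)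
    unfolding s NM N y_def by simp
  also have "Lz (y powi (d - n) * (\<Prod>i<Suc (M + N). 1 + y * fls_const (qvar powi (int i - int N))))
    = Lz (y powi (d - n) * (fls_const (inverse qvar ^ (N * (N + 1) div 2) * C) * (y ^ N * (1 + y) * G)))"
    unfolding C_def G_def y_def
    by (intro Lz_cyc_cong cyc_cong_mult prod_cong \<epsilon> qvar_nonzero nz \<open>M \<le> N\<close>
        laurent_poly_mult laurent_poly_add laurent_poly_powi laurent_poly_const laurent_poly_1
        laurent_poly_X laurent_poly_power laurent_poly_qpoch)
  also have "y powi (d - n) * (fls_const (inverse qvar ^ (N * (N + 1) div 2) * C) * (y ^ N * (1 + y) * G))
    = fls_const (inverse qvar ^ (N * (N + 1) div 2) * C) * (y powi (d - t) * (1 + y) * G)"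
  \<comment> \<open>The N powers of y gained from the product turn y^(d-n) into y^(d-t).\<close>
  proof -
    have "d - t = (d - n) + int N"
      using N by simp
    then have "y powi (d - t) = y powi (d - n) * y ^ N"
      by (simp only: power_int_add[OF disjI1[OF y]] power_int_of_nat)
    then show ?thesis
      by (simp only: mult.assoc mult.left_commute[of "fls_const _"])
  qed
  also have "qvar powi (n * (n + 1) div 2 - t * n) * Lz \<dots>
    = C * (qvar powi ((1 - s\<^sup>2) div 8) * Lz (y powi (d - t) * (1 + y) * G))"
  proof -
    \<comment> \<open>The powers of q collect to n(n+1)/2 - tn - N(N+1)/2 = t(1-t)/2 = (1-s^2)/8.
      The three parity facts make each division an exact one in the integers.\<close>
    have "even (n * (n + 1))" "even (N * (N + 1))" "even (t * (1 - t))"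
      by simp_all
    then obtain v w z where v: "n * (n + 1) = 2 * v" and w: "N * (N + 1) = 2 * w"
      and z: "t * (1 - t) = 2 * z"
      by (blast elim: evenE)
    have "2 * int w = (n - t) * (n - t + 1)"
      using arg_cong[OF w, of int] N by (simp add: distrib_left distrib_right)
    then have "2 * (v - t * n + - int w) = n * (n + 1) - 2 * (t * n) - (n - t) * (n - t + 1)"
      unfolding v by simp
    also have "\<dots> = 2 * z"
      unfolding z[symmetric] by (simp add: algebra_simps)
    finally have "z = v - t * n + - int w"
      by simp
    moreover have "1 - s\<^sup>2 = 4 * (t * (1 - t))"
      unfolding s by (simp add: algebra_simps power2_eq_square)
    then have "(1 - s\<^sup>2) div 8 = z"
      unfolding z by simp
    ultimately have "(1 - s\<^sup>2) div 8 = v - t * n + - int w"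
      by simp
    then have q: "qvar powi ((1 - s\<^sup>2) div 8)
        = qvar powi (n * (n + 1) div 2 - t * n) * inverse qvar ^ (N * (N + 1) div 2)"
      unfolding v w
      by (simp only: power_int_add[OF disjI1[OF qvar_nonzero]] power_int_minus power_int_of_nat
          power_inverse nonzero_mult_div_cancel_left[OF zero_neq_numeral[symmetric]])
    have "a * (b * c * u) = c * (a * b * u)" for a b c u :: qfield
      by simp
    then show ?thesis
      unfolding q Lz_const_mult .
  qed
  also have "qvar powi ((1 - s\<^sup>2) div 8) * Lz (y powi (d - t) * (1 + y) * G)
    = Lz (fls_const (qvar powi ((1 - s\<^sup>2) div 8)) * y powi (d - t) * (1 + y) * G)"
    by (simp only: Lz_const_mult[symmetric] mult.assoc)
  finally show ?thesis
    unfolding MM(1,2) unfolding MM(3) NM(2) nat_int power_int_of_nat C_def G_def y_def .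
qed

end
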